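(* Let $m\ge 2$, $n\ge 1$, and let $A\in\mathbb{R}^{n\times n}$ be diagonalizable over $\mathbb{C}$, with $r\ge 1$ eigenvalues (counted with multiplicity) in the open right half plane $\mathbb{C}^+$. Let $Q$ be an invertible matrix whose columns are eigenvectors of $A$, ordered so that $S:=Q^{-1}AQ=\mathrm{diag}(\lambda_A^1,\dots,\lambda_A^n)$ with $\mathrm{Re}(\lambda_A^1)\ge\cdots\ge \mathrm{Re}(\lambda_A^n)$, $\lambda_A^1,\dots,\lambda_A^r\in\mathbb{C}^+$, and $\lambda_A^{r+1},\dots,\lambda_A^n$ in the closed left half plane. Let $G$ be a fixed (time-independent), connected, directed weighted graph on $\{1,\dots,m\}$ with weights $\alpha_{ij}\ge 0$ and Laplacian matrix $\mathcal{L}$, and let $\lambda_{\mathcal{L}}^2$ denote the second smallest eigenvalue of $\mathcal{L}$. Let $\Gamma=\mathrm{diag}(\gamma^1,\dots,\gamma^n)$ with $\gamma^i\in\mathbb{R}$ and $\gamma^{r+1}=\cdots=\gamma^n=1$. Then the multi-agent system $$\dot{x}_i(t)=S x_i(t)+\Gamma\sum_{j=1}^m\alpha_{ij}\,(x_j(t)-x_i(t)),\qquad i=1,\dots,m,$$ reaches consensus if and only if $$\gamma^i>\frac{\mathrm{Re}(\lambda_A^i)}{\mathrm{Re}(\lambda_{\mathcal{L}}^2)}\quad\text{for all } i=1,\dots,r.$$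
   Context: Graphs: a weighted directed graph on $\{1,\dots,m\}$ has weights $\alpha_{ij}\ge0$ ($i\ne j$); $(i,j)$ is an edge iff $\alpha_{ij}>0$, meaning that $j$ is an in-neighbor of $i$ (the edge is directed from $j$ to $i$). The graph is connected if there is a base node from which every other node can be reached by following the directed edges. The Laplacian $\mathcal{L}\in\mathbb{R}^{m\times m}$ has $\mathcal{L}_{ij}=-\alpha_{ij}$ for $i\neq j$ and $\mathcal{L}_{ii}=\sum_{j\ne i}\alpha_{ij}$. Eigenvalues of $\mathcal{L}$ are counted with algebraic multiplicity and ordered by real part, $\mathrm{Re}(\lambda_{\mathcal{L}}^1)\le \mathrm{Re}(\lambda_{\mathcal{L}}^2)\le\cdots\le\mathrm{Re}(\lambda_{\mathcal{L}}^m)$, with $\lambda_{\mathcal{L}}^1=0$; the second smallest eigenvalue is $\lambda_{\mathcal{L}}^2$. Consensus: the states are $x_i(t)\in\mathbb{C}^n$; the system reaches consensus if for all initial conditions $x_1(0),\dots,x_m(0)$ one has $\|x_i(t)-x_j(t)\|\to 0$ as $t\to\infty$ for all $i,j$. *)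

theory Defs
  imports "Jordan_Normal_Form.Char_Poly" "HOL-Analysis.L2_Norm"
begin

text \<open>
  Nodes and coordinates are numbered from 0, so the nodes are \<open>0, \<dots>, m - 1\<close>.
  The weight \<open>\<alpha> i j\<close> belongs to the edge directed from \<open>j\<close> to \<open>i\<close>;
  the diagonal values \<open>\<alpha> i i\<close> carry no meaning and have no effect below.
\<close>

definition graph_edges :: "nat \<Rightarrow> (nat \<Rightarrow> nat \<Rightarrow> real) \<Rightarrow> (nat \<times> nat) set" where
  "graph_edges m \<alpha> = {(j, i). i < m \<and> j < m \<and> i \<noteq> j \<and> \<alpha> i j > 0}"

definition connected_graph :: "nat \<Rightarrow> (nat \<Rightarrow> nat \<Rightarrow> real) \<Rightarrow> bool" where
  "connected_graph m \<alpha> \<longleftrightarrow> (\<exists>b<m. \<forall>i<m. i \<noteq> b \<longrightarrow> (b, i) \<in> (graph_edges m \<alpha>)\<^sup>*)"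

definition laplacian :: "nat \<Rightarrow> (nat \<Rightarrow> nat \<Rightarrow> real) \<Rightarrow> real mat" where
  "laplacian m \<alpha> =
    mat m m (\<lambda>(i, j). if i = j then (\<Sum>k\<in>{0..<m} - {i}. \<alpha> i k) else - \<alpha> i j)"

abbreviation cmat :: "real mat \<Rightarrow> complex mat" where
  "cmat \<equiv> map_mat complex_of_real"

definition eigenvalues :: "complex mat \<Rightarrow> complex multiset" where
  "eigenvalues M = proots (char_poly M)"

definition diagonalizable :: "complex mat \<Rightarrow> bool" where
  "diagonalizable M \<longleftrightarrow> (\<exists>D. diagonal_mat D \<and> similar_mat M D)"

definition euclidean_norm :: "complex vec \<Rightarrow> real" where
  "euclidean_norm v = L2_set (\<lambda>k. cmod (v $ k)) {0..<dim_vec v}"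

definition has_vec_derivative_within ::
    "nat \<Rightarrow> (real \<Rightarrow> complex vec) \<Rightarrow> complex vec \<Rightarrow> real \<Rightarrow> real set \<Rightarrow> bool" where
  "has_vec_derivative_within n y v t T \<longleftrightarrow>
    (\<forall>k<n. ((\<lambda>s. y s $ k) has_vector_derivative v $ k) (at t within T))"

text \<open>Solutions on \<open>[0, \<infinity>)\<close>; the derivative at time 0 is one-sided.\<close>

definition multi_agent_solution ::
    "nat \<Rightarrow> nat \<Rightarrow> complex mat \<Rightarrow> complex mat \<Rightarrow> (nat \<Rightarrow> nat \<Rightarrow> real) \<Rightarrow>
     (nat \<Rightarrow> real \<Rightarrow> complex vec) \<Rightarrow> bool" where
  "multi_agent_solution n m S \<Gamma> \<alpha> x \<longleftrightarrow>
    (\<forall>i<m. \<forall>t\<ge>0. x i t \<in> carrier_vec n \<and>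
      has_vec_derivative_within n (x i)
        (S *\<^sub>v x i t +
         \<Gamma> *\<^sub>v finsum_vec TYPE(complex) n
               (\<lambda>j. complex_of_real (\<alpha> i j) \<cdot>\<^sub>v (x j t - x i t)) {0..<m})
        t {0..})"

text \<open>
  The initial value problems of this linear system are uniquely solvable, so quantifying over all
  solutions starting in \<open>x0\<close> is the same as speaking about the solution starting in \<open>x0\<close>.
\<close>

definition reaches_consensus ::
    "nat \<Rightarrow> nat \<Rightarrow> complex mat \<Rightarrow> complex mat \<Rightarrow> (nat \<Rightarrow> nat \<Rightarrow> real) \<Rightarrow> bool" where
  "reaches_consensus n m S \<Gamma> \<alpha> \<longleftrightarrow>
    (\<forall>x0. (\<forall>i<m. x0 i \<in> carrier_vec n) \<longrightarrow>
      (\<forall>x. multi_agent_solution n m S \<Gamma> \<alpha> x \<and> (\<forall>i<m. x i 0 = x0 i) \<longrightarrow>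
        (\<forall>i<m. \<forall>j<m. ((\<lambda>t. euclidean_norm (x i t - x j t)) \<longlongrightarrow> 0) at_top)))"

end

theory Submission
  imports Defs "HOL-Analysis.Derivative" "HOL-Real_Asymp.Real_Asymp"
    "Jordan_Normal_Form.Schur_Decomposition"
begin

text \<open>
  Since \<open>S\<close> and \<open>\<Gamma>\<close> are diagonal, each coordinate evolves separately by \<open>y' = (\<lambda> - \<gamma> L) y\<close>.
  A Schur triangularization \<open>L P = P T\<close> whose diagonal is \<open>\<lambda>\<^sub>1 = 0, \<lambda>\<^sub>2, \<dots>, \<lambda>\<^sub>m\<close> turns this into a triangular
  system for \<open>z = P\<inverse> y\<close>. If all \<open>\<lambda> - \<gamma> \<lambda>\<^sub>k\<close> with \<open>k \<ge> 2\<close> lie in the open left half plane, back substitution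
  gives \<open>z\<^sub>k \<longlonglongrightarrow> 0\<close> for \<open>k \<ge> 2\<close>; the remaining mode is the first column of \<open>P\<close>, which is in the
  kernel of \<open>L\<close> and so constant on the nodes. Conversely, an eigenvector \<open>v\<close> for \<open>\<lambda>\<^sub>2\<close> gives the solution
  \<open>exp ((\<lambda> - \<gamma> \<lambda>\<^sub>2) t) v\<close>, and \<open>v\<close> is not constant because \<open>\<lambda>\<^sub>2 \<noteq> 0\<close>.

  The eigenvalue 0 is algebraically simple because \<open>L v = c 1\<close> with \<open>c \<noteq> 0\<close> is impossible at a node
  minimizing the real part of \<open>v / c\<close>, while a second zero on the diagonal of \<open>T\<close> would produce such
  a \<open>v\<close> or a second vector in the kernel.
\<close>

unbundle no vec_syntax

section \<open>Asymptotic stability of triangular linear systems\<close>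

text \<open>The integrating factor \<open>exp (- a * t)\<close> removes the homogeneous part. Once
  the forcing is small, its accumulated effect stays below \<open>e / 2\<close>, and what the past
  left behind decays exponentially.\<close>

lemma forced_scalar_ode_tendsto_0:
  fixes z f :: "real \<Rightarrow> complex"
  assumes a: "Re a < 0"
    and z: "\<And>t. t \<ge> 0 \<Longrightarrow> (z has_vector_derivative a * z t + f t) (at t within {0..})"
    and f: "(f \<longlongrightarrow> 0) at_top"
  shows "(z \<longlongrightarrow> 0) at_top"
proof (rule tendstoI)
  fix e :: real
  assume e: "e > 0"
  define \<sigma> where "\<sigma> = - Re a"
  have \<sigma>: "\<sigma> > 0"
    using a by (simp add: \<sigma>_def)
  \<comment> \<open>A forcing of size \<open>d\<close> contributes at most
    \<open>d / \<sigma>\<close> to the solution, so this threshold yields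
    \<open>e / 2\<close>.\<close>
  have "\<forall>\<^sub>F t in at_top. norm (f t) < \<sigma> * e / 2"
    using tendstoD[OF f, of "\<sigma> * e / 2"] \<sigma> e by (simp add: dist_norm)
  then obtain T0 where T0: "\<And>t. t \<ge> T0 \<Longrightarrow> norm (f t) < \<sigma> * e / 2"
    by (auto simp: eventually_at_top_linorder)
  define T where "T = max T0 0"
  have T: "T \<ge> 0" "\<And>t. t \<ge> T \<Longrightarrow> norm (f t) \<le> \<sigma> * e / 2"
    using T0 by (auto simp: T_def intro: less_imp_le)
  define w where "w = (\<lambda>s. exp (- a * of_real s) * z s)"
  \<comment> \<open>Majorant for the growth of \<open>w\<close>: its derivative is the bound on the
    norm of \<open>w'\<close> beyond \<open>T\<close>.\<close>
  define \<phi> where "\<phi> = (\<lambda>s. e / 2 * exp (\<sigma> * s))"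
  have norm_exp: "norm (exp (- a * of_real s)) = exp (\<sigma> * s)" for s :: real
    by (simp add: \<sigma>_def)
  have w': "(w has_vector_derivative exp (- a * of_real s) * f s) (at s within {0..})" if "s \<ge> 0" for s
  proof -
    have "((\<lambda>s. exp (- a * of_real s)) has_vector_derivative - a * exp (- a * of_real s))
        (at s within {0..})"
      using exp_scaleR_has_vector_derivative_right[of "- a" s "{0..}"]
      by (simp add: scaleR_conv_of_real mult.commute)
    from has_vector_derivative_mult[OF this z[OF that]] show ?thesis
      unfolding w_def by (simp add: algebra_simps)
  qed
  have bound: "norm (z t) \<le> exp (- \<sigma> * t) * norm (w T) + e / 2" if "t > T" for t
  proof -
    have "norm (w t - w T) \<le> \<phi> t - \<phi> T"
    proof (rule differentiable_bound_general[OF that])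
      show "continuous_on {T..t} w"
        unfolding continuous_on_eq_continuous_within
        using T(1) by (auto intro!: has_vector_derivative_continuous
          has_vector_derivative_within_subset[OF w'])
      show "continuous_on {T..t} \<phi>"
        unfolding \<phi>_def by (intro continuous_intros)
      fix s assume s: "T < s" "s < t"
      \<comment> \<open>Passing to the open half line turns the one-sided derivative into the full
        one that the mean value bound asks for.\<close>
      have "(w has_vector_derivative exp (- a * of_real s) * f s) (at s within {0<..})"
        by (rule has_vector_derivative_within_subset[OF w']) (use s T(1) in auto)
      then show "(w has_vector_derivative exp (- a * of_real s) * f s) (at s)"
        using s T(1) by (subst (asm) has_vector_derivative_within_open) auto
      show "(\<phi> has_vector_derivative \<sigma> * e / 2 * exp (\<sigma> * s)) (at s)"
        unfolding \<phi>_def has_real_derivative_iff_has_vector_derivative[symmetric]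
        by (auto intro!: derivative_eq_intros)
      have "exp (\<sigma> * s) * norm (f s) \<le> exp (\<sigma> * s) * (\<sigma> * e / 2)"
        using s by (intro mult_left_mono T) auto
      then show "norm (exp (- a * of_real s) * f s) \<le> \<sigma> * e / 2 * exp (\<sigma> * s)"
        unfolding norm_mult norm_exp by (simp add: mult_ac)
    qed
    moreover have "\<phi> T \<ge> 0"
      using e by (simp add: \<phi>_def)
    ultimately have "norm (w t) \<le> norm (w T) + \<phi> t"
      using norm_triangle_ineq2[of "w t" "w T"] by linarith
    then have "exp (\<sigma> * t) * norm (z t) \<le> norm (w T) + e / 2 * exp (\<sigma> * t)"
      unfolding w_def \<phi>_def norm_mult norm_exp .
    then have "exp (- \<sigma> * t) * (exp (\<sigma> * t) * norm (z t))
        \<le> exp (- \<sigma> * t) * (norm (w T) + e / 2 * exp (\<sigma> * t))"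
      by (intro mult_left_mono) auto
    also have "\<dots> = exp (- \<sigma> * t) * norm (w T) + e / 2"
      by (simp add: distrib_left mult.left_commute[of _ "e / 2"] flip: exp_add)
    also have "exp (- \<sigma> * t) * (exp (\<sigma> * t) * norm (z t)) = norm (z t)"
      by (simp add: mult.assoc[symmetric] flip: exp_add)
    finally show ?thesis .
  qed
  have "((\<lambda>t. exp (- \<sigma> * t) * norm (w T)) \<longlongrightarrow> 0) at_top"
    using \<sigma> by real_asymp
  from tendstoD[OF this, of "e / 2"] e
  have "\<forall>\<^sub>F t in at_top. exp (- \<sigma> * t) * norm (w T) < e / 2"
    by (simp add: dist_norm)
  then show "\<forall>\<^sub>F t in at_top. dist (z t) 0 < e"
    using eventually_gt_at_top[of T]
  proof eventually_elim
    case (elim t)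
    then show ?case
      using bound[of t] by (simp add: dist_norm)
  qed
qed

text \<open>Row \<open>i\<close> involves only the coordinates from \<open>i\<close> on, so the rows
  are solved from the last one upwards, the later coordinates acting as a vanishing forcing
  term.\<close>

lemma upper_triangular_ode_tendsto_0:
  fixes z :: "nat \<Rightarrow> real \<Rightarrow> complex" and c :: "nat \<Rightarrow> nat \<Rightarrow> complex"
  assumes z: "\<And>i t. i < m \<Longrightarrow> t \<ge> 0 \<Longrightarrow>
      (z i has_vector_derivative (\<Sum>j\<in>{0..<m}. c i j * z j t)) (at t within {0..})"
    and upper: "\<And>i j. i < m \<Longrightarrow> j < i \<Longrightarrow> c i j = 0"
    and stable: "\<And>i. p \<le> i \<Longrightarrow> i < m \<Longrightarrow> Re (c i i) < 0"
    and i: "p \<le> i" "i < m"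
  shows "(z i \<longlongrightarrow> 0) at_top"
  using i
proof (induction "m - i" arbitrary: i rule: less_induct)
  case less
  define f where "f = (\<lambda>t. \<Sum>j\<in>{i<..<m}. c i j * z j t)"
  have "(\<Sum>j\<in>{0..<m}. c i j * z j t) = c i i * z i t + f t" for t
  proof -
    have split: "{0..<m} = {0..<i} \<union> insert i {i<..<m}"
      using less.prems by auto
    have "(\<Sum>j\<in>{0..<m}. c i j * z j t)
        = (\<Sum>j\<in>{0..<i}. c i j * z j t) + (\<Sum>j\<in>insert i {i<..<m}. c i j * z j t)"
      unfolding split by (rule sum.union_disjoint) auto
    moreover have "(\<Sum>j\<in>{0..<i}. c i j * z j t) = 0"
      using upper[OF less.prems(2)] by (intro sum.neutral) auto
    ultimately show ?thesis
      by (simp add: f_def)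
  qed
  then have "t \<ge> 0 \<Longrightarrow> (z i has_vector_derivative c i i * z i t + f t) (at t within {0..})" for t
    using z[of i t] less.prems by simp
  moreover have "(f \<longlongrightarrow> 0) at_top"
    unfolding f_def
  proof (rule tendsto_null_sum)
    fix j assume "j \<in> {i<..<m}"
    then show "((\<lambda>t. c i j * z j t) \<longlongrightarrow> 0) at_top"
      using less.hyps[of j] less.prems by (intro tendsto_mult_right_zero) auto
  qed
  ultimately show ?case
    using forced_scalar_ode_tendsto_0[OF stable[OF less.prems]] by blast
qed

text \<open>Schur decomposition with a prescribed order \<open>es\<close> of the diagonal, so that
  the eigenvalue 0 can be put first. \<open>B * P = P * T\<close> serves the columns of
  \<open>P\<close>, and \<open>R * B = T * R\<close> the change of coordinates by
  \<open>R\<close>.\<close>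

lemma complex_triangularization:
  fixes B :: "complex mat"
  assumes B: "B \<in> carrier_mat n n" and es: "mset es = proots (char_poly B)"
  obtains P T R where "P \<in> carrier_mat n n" "T \<in> carrier_mat n n" "R \<in> carrier_mat n n"
    "P * R = 1\<^sub>m n" "R * P = 1\<^sub>m n" "B * P = P * T" "R * B = T * R"
    "upper_triangular T" "\<And>i. i < n \<Longrightarrow> T $$ (i, i) = es ! i"
proof -
  have "lead_coeff (char_poly B) = 1"
    using degree_monic_char_poly[OF B] by simp
  then have "char_poly B = (\<Prod>x\<in>#proots (char_poly B). [:-x, 1:])"
    using complex_poly_decompose_multiset[of "char_poly B"] by simp
  also have "\<dots> = (\<Prod>x\<leftarrow>es. [:-x, 1:])"
    by (subst prod_mset_prod_list [symmetric]) (simp add: es)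
  finally have cp: "char_poly B = (\<Prod>x\<leftarrow>es. [:-x, 1:])" .
  obtain T P R where "schur_decomposition B es = (T, P, R)"
    by (cases "schur_decomposition B es")
  from schur_decomposition[OF B cp this]
  have sim: "similar_mat_wit B T P R" and up: "upper_triangular T" and diag: "diag_mat T = es"
    by auto
  note w = similar_mat_witD2[OF B sim]
  have "B * P = P * T * (R * P)"
    unfolding w(3) using w by (simp add: assoc_mult_mat[of _ n n _ n _ n])
  then have BP: "B * P = P * T"
    using w by (simp add: right_mult_one_mat[of _ n n])
  have "R * B = R * (P * (T * R))"
    unfolding w(3) using w(5-7) by (simp add: assoc_mult_mat[of _ n n _ n _ n])
  also have "\<dots> = (R * P) * (T * R)"
    using w(5-7) by (intro assoc_mult_mat[symmetric, of _ n n _ n _ n]) auto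
  finally have RB: "R * B = T * R"
    using w(2,5-7) by (simp add: left_mult_one_mat[of _ n n])
  show thesis
  proof (rule that[of P T R])
    show "T $$ (i, i) = es ! i" if "i < n" for i
      unfolding diag[symmetric] diag_mat_def using w that by simp
  qed (use w BP RB up in auto)
qed

section \<open>The Laplacian: kernel, range and spectrum\<close>

lemma laplacian_carrier [simp]: "laplacian m \<alpha> \<in> carrier_mat m m"
  by (simp add: laplacian_def)

text \<open>The sum may run over all nodes, because the difference vanishes at \<open>k = i\<close>,
  whatever the value of \<open>\<alpha> i i\<close>.\<close>

lemma laplacian_mult_vec_index:
  assumes v: "v \<in> carrier_vec m" and i: "i < m"
  shows "(cmat (laplacian m \<alpha>) *\<^sub>v v) $ i
    = (\<Sum>k\<in>{0..<m}. complex_of_real (\<alpha> i k) * (v $ i - v $ k))"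
proof -
  have "(cmat (laplacian m \<alpha>) *\<^sub>v v) $ i
      = (\<Sum>k\<in>{0..<m}. cmat (laplacian m \<alpha>) $$ (i, k) * v $ k)"
    using v i by (simp add: scalar_prod_def laplacian_def)
  also have "\<dots> = cmat (laplacian m \<alpha>) $$ (i, i) * v $ i
      + (\<Sum>k\<in>{0..<m} - {i}. cmat (laplacian m \<alpha>) $$ (i, k) * v $ k)"
    using i by (intro sum.remove) auto
  also have "(\<Sum>k\<in>{0..<m} - {i}. cmat (laplacian m \<alpha>) $$ (i, k) * v $ k)
      = (\<Sum>k\<in>{0..<m} - {i}. - complex_of_real (\<alpha> i k) * v $ k)"
    using i by (intro sum.cong) (auto simp: laplacian_def)
  also have "cmat (laplacian m \<alpha>) $$ (i, i) * v $ i
      = (\<Sum>k\<in>{0..<m} - {i}. complex_of_real (\<alpha> i k) * v $ i)"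
    using i by (simp add: laplacian_def sum_distrib_right)
  also have "\<dots> + (\<Sum>k\<in>{0..<m} - {i}. - complex_of_real (\<alpha> i k) * v $ k)
      = (\<Sum>k\<in>{0..<m} - {i}. complex_of_real (\<alpha> i k) * (v $ i - v $ k))"
    by (simp add: sum.distrib[symmetric] algebra_simps)
  also have "\<dots> = (\<Sum>k\<in>{0..<m}. complex_of_real (\<alpha> i k) * (v $ i - v $ k))"
    using i by (subst (2) sum.remove[of _ i]) auto
  finally show ?thesis .
qed

lemma finite_nat_argmax:
  fixes u :: "nat \<Rightarrow> real"
  assumes "m > 0"
  obtains i where "i < m" "\<And>j. j < m \<Longrightarrow> u j \<le> u i"
proof -
  have "Max (u ` {0..<m}) \<in> u ` {0..<m}"
    using assms by (intro Max_in) auto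
  then obtain i where "i < m" "u i = Max (u ` {0..<m})"
    by auto
  then show thesis
    by (intro that[of i]) auto
qed

text \<open>Maximality spreads from a node to its in-neighbours, hence up every path to the base node.\<close>

lemma harmonic_le_base:
  fixes u :: "nat \<Rightarrow> real"
  assumes nonneg: "\<forall>i<m. \<forall>j<m. i \<noteq> j \<longrightarrow> \<alpha> i j \<ge> 0"
    and b: "\<And>i. i < m \<Longrightarrow> i \<noteq> b \<Longrightarrow> (b, i) \<in> (graph_edges m \<alpha>)\<^sup>*"
    and harmonic: "\<And>i. i < m \<Longrightarrow> (\<Sum>k\<in>{0..<m}. \<alpha> i k * (u i - u k)) = 0"
    and j: "j < m"
  shows "u j \<le> u b"
proof -
  obtain i where i: "i < m" and max: "\<And>j. j < m \<Longrightarrow> u j \<le> u i"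
    using finite_nat_argmax[of m u] j by (metis less_nat_zero_code neq0_conv)
  have step: "u k = u i" if edge: "(k, l) \<in> graph_edges m \<alpha>" and l: "u l = u i" for k l
  proof -
    \<comment> \<open>At a maximal node \<open>l\<close> all summands are nonnegative and add up to
      0, so each vanishes; a positive weight then forces equal values.\<close>
    from edge have kl: "k < m" "l < m" "\<alpha> l k > 0"
      by (auto simp: graph_edges_def)
    have "\<forall>k'\<in>{0..<m}. \<alpha> l k' * (u l - u k') = 0"
    proof (rule sum_nonneg_eq_0_iff[THEN iffD1, OF _ _ harmonic[OF kl(2)]])
      fix k' assume "k' \<in> {0..<m}"
      then show "0 \<le> \<alpha> l k' * (u l - u k')"
        using nonneg kl l max[of k'] by (cases "k' = l") auto
    qed simp
    with kl(1) have "\<alpha> l k * (u l - u k) = 0"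
      by simp
    then show ?thesis
      using kl(3) l by simp
  qed
  have "u b = u i"
  proof (cases "i = b")
    case False
    from b[OF i False] show ?thesis
      \<comment> \<open>The induction walks the path backwards, from \<open>i\<close> to
        \<open>b\<close>, against the direction of the edges.\<close>
      by (induction rule: converse_rtrancl_induct) (auto intro: step)
  qed simp
  then show ?thesis
    using max[OF j] by simp
qed

text \<open>The weights are real, so real and imaginary part are each harmonic; the maximum
  principle for them and their negatives pins every value to that at the base node.\<close>

lemma laplacian_kernel_const:
  assumes nonneg: "\<forall>i<m. \<forall>j<m. i \<noteq> j \<longrightarrow> \<alpha> i j \<ge> 0"
    and conn: "connected_graph m \<alpha>"
    and v: "v \<in> carrier_vec m" and ker: "cmat (laplacian m \<alpha>) *\<^sub>v v = 0\<^sub>v m"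
    and ij: "i < m" "j < m"
  shows "v $ i = v $ j"
proof -
  obtain b where b: "b < m" "\<And>i. i < m \<Longrightarrow> i \<noteq> b \<Longrightarrow> (b, i) \<in> (graph_edges m \<alpha>)\<^sup>*"
    using conn by (auto simp: connected_graph_def)
  have zero: "(\<Sum>k\<in>{0..<m}. complex_of_real (\<alpha> i k) * (v $ i - v $ k)) = 0" if "i < m" for i
    using laplacian_mult_vec_index[OF v that, of \<alpha>] that by (simp add: ker)
  \<comment> \<open>Here \<open>g\<close> stands for \<open>Re\<close> or \<open>Im\<close>; only
    additivity and compatibility with real factors enter.\<close>
  have const: "u i = u b"
    if lin: "\<And>a x y. g (complex_of_real a * (x - y)) = a * (g x - g y)"
      and sum: "\<And>f. g (\<Sum>k\<in>{0..<m}. f k) = (\<Sum>k\<in>{0..<m}. g (f k))"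
      and u: "u = (\<lambda>i. g (v $ i))" and i: "i < m" for g :: "complex \<Rightarrow> real" and u i
  proof -
    have "g 0 = 0"
      using lin[of 0 0 0] by simp
    then have h: "(\<Sum>k\<in>{0..<m}. \<alpha> i k * (u i - u k)) = 0" if "i < m" for i
      using arg_cong[OF zero[OF that], of g] by (simp add: sum lin u)
    have "u i \<le> u b"
      by (rule harmonic_le_base[OF nonneg b(2) h i])
    moreover have "- u i \<le> - u b"
    proof (rule harmonic_le_base[OF nonneg b(2) _ i, of "\<lambda>i. - u i"])
      fix i assume "i < m"
      have "(\<Sum>k\<in>{0..<m}. \<alpha> i k * (- u i - - u k)) = - (\<Sum>k\<in>{0..<m}. \<alpha> i k * (u i - u k))"
        by (simp add: sum_negf[symmetric] algebra_simps)
      with h[OF \<open>i < m\<close>] show "(\<Sum>k\<in>{0..<m}. \<alpha> i k * (- u i - - u k)) = 0"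
        by simp
    qed
    ultimately show ?thesis
      by simp
  qed
  have "v $ i = v $ b" if "i < m" for i
    using const[of Re, OF _ _ refl that] const[of Im, OF _ _ refl that] by (simp add: complex_eq_iff)
  then show ?thesis
    using ij by simp
qed

text \<open>Excludes a Jordan chain above the constant eigenvector. After division by
  \<open>c\<close> the image would be 1 everywhere, yet at a node with minimal real part no summand
  has a positive real part.\<close>

lemma ones_not_in_laplacian_range:
  assumes nonneg: "\<forall>i<m. \<forall>j<m. i \<noteq> j \<longrightarrow> \<alpha> i j \<ge> 0"
    and m: "m > 0" and v: "v \<in> carrier_vec m" and c: "c \<noteq> 0"
  shows "cmat (laplacian m \<alpha>) *\<^sub>v v \<noteq> Matrix.vec m (\<lambda>_. c)"
proof
  assume eq: "cmat (laplacian m \<alpha>) *\<^sub>v v = Matrix.vec m (\<lambda>_. c)"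
  define u where "u i = Re (v $ i / c)" for i
  obtain i where i: "i < m" "\<And>j. j < m \<Longrightarrow> - u j \<le> - u i"
    using finite_nat_argmax[OF m, of "\<lambda>i. - u i"] by metis
  have "(\<Sum>k\<in>{0..<m}. complex_of_real (\<alpha> i k) * (v $ i / c - v $ k / c))
      = (\<Sum>k\<in>{0..<m}. complex_of_real (\<alpha> i k) * (v $ i - v $ k) / c)"
    by (rule sum.cong) (simp_all add: diff_divide_distrib[symmetric])
  also have "\<dots> = (\<Sum>k\<in>{0..<m}. complex_of_real (\<alpha> i k) * (v $ i - v $ k)) / c"
    by (rule sum_divide_distrib[symmetric])
  also have "\<dots> = 1"
    unfolding laplacian_mult_vec_index[OF v i(1), symmetric] eq using i(1) c by simp
  finally have "(\<Sum>k\<in>{0..<m}. complex_of_real (\<alpha> i k) * (v $ i / c - v $ k / c)) = 1" .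
  then have "Re (\<Sum>k\<in>{0..<m}. complex_of_real (\<alpha> i k) * (v $ i / c - v $ k / c)) = 1"
    by simp
  then have "(\<Sum>k\<in>{0..<m}. \<alpha> i k * (u i - u k)) = 1"
    by (simp add: u_def)
  moreover have "(\<Sum>k\<in>{0..<m}. \<alpha> i k * (u i - u k)) \<le> 0"
  proof (rule sum_nonpos)
    fix k assume "k \<in> {0..<m}"
    then show "\<alpha> i k * (u i - u k) \<le> 0"
      using i nonneg by (cases "k = i") (auto intro: mult_nonneg_nonpos)
  qed
  ultimately show False
    by simp
qed

text \<open>Gershgorin's theorem: the eigenvalue lies in a disc around \<open>d \<ge> 0\<close> with radius \<open>d\<close>.\<close>

lemma laplacian_eigenvalue_Re:
  assumes nonneg: "\<forall>i<m. \<forall>j<m. i \<noteq> j \<longrightarrow> \<alpha> i j \<ge> 0"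
    and ev: "eigenvector (cmat (laplacian m \<alpha>)) v \<mu>"
  shows "\<mu> = 0 \<or> Re \<mu> > 0"
proof -
  have v: "v \<in> carrier_vec m" "v \<noteq> 0\<^sub>v m" "cmat (laplacian m \<alpha>) *\<^sub>v v = \<mu> \<cdot>\<^sub>v v"
    using ev by (auto simp: eigenvector_def laplacian_def)
  then have "m > 0"
    by (auto intro!: gr0I)
  then obtain i where i: "i < m" "\<And>j. j < m \<Longrightarrow> cmod (v $ j) \<le> cmod (v $ i)"
    using finite_nat_argmax[of m "\<lambda>i. cmod (v $ i)"] by metis
  \<comment> \<open>Needed to cancel \<open>cmod (v $ i)\<close> from the row estimate
    below.\<close>
  have vi: "cmod (v $ i) > 0"
  proof (rule ccontr)
    assume "\<not> cmod (v $ i) > 0"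
    then have "v $ j = 0" if "j < m" for j
      using i(2)[OF that] by auto
    then have "v = 0\<^sub>v m"
      using v(1) by (intro eq_vecI) auto
    with v(2) show False ..
  qed
  define d where "d = (\<Sum>k\<in>{0..<m} - {i}. \<alpha> i k)"
  have "\<mu> * v $ i = (\<Sum>k\<in>{0..<m}. complex_of_real (\<alpha> i k) * (v $ i - v $ k))"
    using laplacian_mult_vec_index[OF v(1) i(1), of \<alpha>] v i(1) by simp
  also have "\<dots> = (\<Sum>k\<in>{0..<m} - {i}. complex_of_real (\<alpha> i k) * (v $ i - v $ k))"
    using i by (subst sum.remove[of _ i]) auto
  also have "\<dots> = of_real d * v $ i - (\<Sum>k\<in>{0..<m} - {i}. complex_of_real (\<alpha> i k) * v $ k)"
    by (simp add: d_def sum_distrib_right right_diff_distrib sum_subtractf)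
  finally have "(of_real d - \<mu>) * v $ i = (\<Sum>k\<in>{0..<m} - {i}. complex_of_real (\<alpha> i k) * v $ k)"
    by (simp add: algebra_simps)
  then have "cmod (of_real d - \<mu>) * cmod (v $ i)
      = cmod (\<Sum>k\<in>{0..<m} - {i}. complex_of_real (\<alpha> i k) * v $ k)"
    by (metis norm_mult)
  also have "\<dots> \<le> (\<Sum>k\<in>{0..<m} - {i}. \<alpha> i k * cmod (v $ i))"
    using i nonneg by (intro sum_norm_le) (auto simp: norm_mult intro!: mult_mono)
  also have "\<dots> = d * cmod (v $ i)"
    by (simp add: d_def sum_distrib_right)
  finally have "cmod (of_real d - \<mu>) \<le> d"
    using vi by simp
  then have "(cmod (of_real d - \<mu>))\<^sup>2 \<le> d\<^sup>2"
    by (intro power_mono) auto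
  \<comment> \<open>The squared disc condition: the disc meets the closed left half plane at most in
    0.\<close>
  then have "(Re \<mu>)\<^sup>2 + (Im \<mu>)\<^sup>2 \<le> 2 * d * Re \<mu>"
    unfolding cmod_power2 by (simp add: power2_eq_square algebra_simps)
  moreover have "d \<ge> 0"
    unfolding d_def using i nonneg by (intro sum_nonneg) auto
  ultimately have "(Re \<mu>)\<^sup>2 + (Im \<mu>)\<^sup>2 \<le> 0" if "Re \<mu> \<le> 0"
    using mult_nonneg_nonpos[of "2 * d" "Re \<mu>"] that by linarith
  then show ?thesis
    by (auto simp: sum_power2_le_zero_iff complex_eq_iff not_less)
qed

lemma laplacian_mult_const_vec:
  "cmat (laplacian m \<alpha>) *\<^sub>v Matrix.vec m (\<lambda>_. c) = 0\<^sub>v m"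
proof (rule eq_vecI)
  fix i assume "i < dim_vec (0\<^sub>v m :: complex Matrix.vec)"
  then show "(cmat (laplacian m \<alpha>) *\<^sub>v Matrix.vec m (\<lambda>_. c)) $ i = 0\<^sub>v m $ i"
    by (subst laplacian_mult_vec_index) auto
qed (simp add: laplacian_def)

lemma mem_eigenvalues_laplacian_iff:
  assumes "m > 0"
  shows "z \<in># eigenvalues (cmat (laplacian m \<alpha>)) \<longleftrightarrow> eigenvalue (cmat (laplacian m \<alpha>)) z"
proof -
  have L: "cmat (laplacian m \<alpha>) \<in> carrier_mat m m"
    by simp
  have "char_poly (cmat (laplacian m \<alpha>)) \<noteq> 0"
    using degree_monic_char_poly[OF L] by auto
  then show ?thesis
    unfolding eigenvalues_def eigenvalue_root_char_poly[OF L] by simp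
qed

text \<open>Gershgorin and the sorting put 0 first. If 0 also came second, the first two columns of
  \<open>P\<close> would both be constant vectors, which invertibility of \<open>P\<close>
  forbids.\<close>

lemma laplacian_spectrum:
  fixes lamL :: "complex list"
  assumes m: "m \<ge> 2"
    and nonneg: "\<forall>i<m. \<forall>j<m. i \<noteq> j \<longrightarrow> \<alpha> i j \<ge> 0"
    and conn: "connected_graph m \<alpha>"
    and lamL: "mset lamL = eigenvalues (cmat (laplacian m \<alpha>))"
    and sorted: "sorted (map Re lamL)"
  shows "length lamL = m" and "lamL ! 0 = 0" and "Re (lamL ! 1) > 0"
proof -
  let ?L = "cmat (laplacian m \<alpha>)"
  have L: "?L \<in> carrier_mat m m"
    by simp
  have "length lamL = size (eigenvalues ?L)"
    by (simp flip: lamL)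
  also have "\<dots> = m"
    using degree_monic_char_poly[OF L] by (simp add: eigenvalues_def size_proots_complex)
  finally show len: "length lamL = m" .
  have ev: "lamL ! k = 0 \<or> Re (lamL ! k) > 0" if "k < m" for k
  proof -
    have "lamL ! k \<in># mset lamL"
      using that len by simp
    then have "eigenvalue ?L (lamL ! k)"
      unfolding lamL using m by (simp add: mem_eigenvalues_laplacian_iff)
    then show ?thesis
      unfolding eigenvalue_def using laplacian_eigenvalue_Re[OF nonneg] by blast
  qed
  have "Matrix.vec m (\<lambda>_. 1 :: complex) \<noteq> 0\<^sub>v m"
  proof
    assume "Matrix.vec m (\<lambda>_. 1 :: complex) = 0\<^sub>v m"
    then have "Matrix.vec m (\<lambda>_. 1 :: complex) $ 0 = 0\<^sub>v m $ 0"
      by simp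
    then show False
      using m by simp
  qed
  then have "eigenvector ?L (Matrix.vec m (\<lambda>_. 1)) 0"
    unfolding eigenvector_def laplacian_mult_const_vec by (auto simp: laplacian_def)
  then have "eigenvalue ?L 0"
    by (auto simp: eigenvalue_def)
  then have "0 \<in># mset lamL"
    unfolding lamL using m by (simp add: mem_eigenvalues_laplacian_iff)
  then obtain k where k: "k < m" "lamL ! k = 0"
    using len by (auto simp: in_set_conv_nth)
  \<comment> \<open>The first entry has real part at most 0, which by \<open>ev\<close> leaves only
    the value 0.\<close>
  have "Re (lamL ! 0) \<le> Re (lamL ! k)"
    using sorted_nth_mono[OF sorted, of 0 k] k len by simp
  then show zero: "lamL ! 0 = 0"
    using ev[of 0] k m by auto
  obtain P T R where P: "P \<in> carrier_mat m m" and T: "T \<in> carrier_mat m m"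
    and R: "R \<in> carrier_mat m m" and PR: "P * R = 1\<^sub>m m" and RP: "R * P = 1\<^sub>m m"
    and LP: "?L * P = P * T" and RL: "R * ?L = T * R"
    and up: "upper_triangular T" and diag: "\<And>i. i < m \<Longrightarrow> T $$ (i, i) = lamL ! i"
    by (rule complex_triangularization[OF L lamL[unfolded eigenvalues_def]]) blast
  have colP: "?L *\<^sub>v col P j = P *\<^sub>v col T j" if "j < m" for j
    using col_mult2[OF L P that] col_mult2[OF P T that] LP by simp
  have col_P: "col P j \<in> carrier_vec m" for j
    using col_dim[of P j] P by simp
  have const: "\<exists>p. col P j = Matrix.vec m (\<lambda>_. p)" if "?L *\<^sub>v col P j = 0\<^sub>v m" "j < m" for j
  proof (intro exI eq_vecI)
    fix i assume "i < dim_vec (Matrix.vec m (\<lambda>_. col P j $ 0))"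
    then show "col P j $ i = Matrix.vec m (\<lambda>_. col P j $ 0) $ i"
      using laplacian_kernel_const[OF nonneg conn col_P that(1), of i 0] m by simp
  qed (use P in auto)
  have "col T 0 = 0\<^sub>v m"
  proof (rule eq_vecI)
    fix i assume "i < dim_vec (0\<^sub>v m :: complex Matrix.vec)"
    then show "col T 0 $ i = 0\<^sub>v m $ i"
      using upper_triangularD[OF up, of 0 i] diag[of 0] zero T m by (cases "i = 0") auto
  qed (use T in auto)
  moreover have "P *\<^sub>v 0\<^sub>v m = 0\<^sub>v m"
    by (rule eq_vecI) (use P in auto)
  ultimately have L0: "?L *\<^sub>v col P 0 = 0\<^sub>v m"
    using colP[of 0] m by simp
  then obtain p where p: "col P 0 = Matrix.vec m (\<lambda>_. p)"
    using const[of 0] m by auto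
  show "Re (lamL ! 1) > 0"
  proof (rule ccontr)
    assume "\<not> Re (lamL ! 1) > 0"
    then have one: "lamL ! 1 = 0"
      using ev[of 1] m by auto
    define c where "c = T $$ (0, 1)"
    \<comment> \<open>With both leading diagonal entries zero, only the entry above the diagonal can
      survive in this column.\<close>
    have "col T 1 = c \<cdot>\<^sub>v unit_vec m 0"
    proof (rule eq_vecI)
      fix i assume "i < dim_vec (c \<cdot>\<^sub>v unit_vec m 0)"
      then show "col T 1 $ i = (c \<cdot>\<^sub>v unit_vec m 0) $ i"
        using upper_triangularD[OF up, of 1 i] diag[of 1] one T m
        by (cases "i = 0"; cases "i = 1") (auto simp: c_def)
    qed (use T in auto)
    moreover have "P *\<^sub>v unit_vec m 0 = col P 0"
      by (rule eq_vecI) (use P m in auto)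
    ultimately have "?L *\<^sub>v col P 1 = c \<cdot>\<^sub>v col P 0"
      using colP[of 1] mult_mat_vec[OF P, of "unit_vec m 0" c] m by simp
    also have "\<dots> = Matrix.vec m (\<lambda>_. c * p)"
      unfolding p by auto
    finally have L1: "?L *\<^sub>v col P 1 = Matrix.vec m (\<lambda>_. c * p)" .
    have "c * p = 0"
      using ones_not_in_laplacian_range[OF nonneg, OF _ col_P[of 1], of "c * p"] L1 m by auto
    then have "?L *\<^sub>v col P 1 = 0\<^sub>v m"
      unfolding L1 by auto
    then obtain q where q: "col P 1 = Matrix.vec m (\<lambda>_. q)"
      using const[of 1] m by auto
    \<comment> \<open>A row of \<open>R\<close> times a constant column of \<open>P\<close> is the
      row sum times the constant. Row 0 forces \<open>q = 0\<close>, which contradicts row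
      1.\<close>
    have RP_entry: "(\<Sum>k\<in>{0..<m}. R $$ (i, k)) * s = 1\<^sub>m m $$ (i, j)"
      if "col P j = Matrix.vec m (\<lambda>_. s)" "i < m" "j < m" for i j s
    proof -
      have "1\<^sub>m m $$ (i, j) = Matrix.row R i \<bullet> col P j"
        unfolding RP[symmetric] using R P that by (intro index_mult_mat) auto
      also have "\<dots> = (\<Sum>k\<in>{0..<m}. R $$ (i, k) * s)"
        unfolding that(1) scalar_prod_def using R that(2) by simp
      finally show ?thesis
        by (simp add: sum_distrib_right)
    qed
    have "(\<Sum>k\<in>{0..<m}. R $$ (0, k)) * p = 1" "(\<Sum>k\<in>{0..<m}. R $$ (0, k)) * q = 0"
        "(\<Sum>k\<in>{0..<m}. R $$ (1, k)) * q = 1"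
      using RP_entry[OF p, of 0] RP_entry[OF q, of 0] RP_entry[OF q, of 1] m by simp_all
    then show False
      by (metis mult_eq_0_iff zero_neq_one)
  qed
qed

section \<open>Consensus in a single coordinate\<close>

text \<open>Stability is required from index 1 on only: mode 0 moves all nodes alike and cancels in
  differences, even when it grows.\<close>

lemma scalar_consensus:
  fixes y :: "nat \<Rightarrow> real \<Rightarrow> complex" and lamL :: "complex list"
  assumes m: "m \<ge> 2"
    and nonneg: "\<forall>i<m. \<forall>j<m. i \<noteq> j \<longrightarrow> \<alpha> i j \<ge> 0"
    and conn: "connected_graph m \<alpha>"
    and lamL: "mset lamL = eigenvalues (cmat (laplacian m \<alpha>))"
    and zero: "lamL ! 0 = 0"
    and y: "\<And>i t. i < m \<Longrightarrow> t \<ge> 0 \<Longrightarrow>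
      (y i has_vector_derivative
        l * y i t + g * (\<Sum>j\<in>{0..<m}. complex_of_real (\<alpha> i j) * (y j t - y i t))) (at t within {0..})"
    and stable: "\<And>k. 1 \<le> k \<Longrightarrow> k < m \<Longrightarrow> Re (l - g * lamL ! k) < 0"
    and ij: "i < m" "j < m"
  shows "((\<lambda>t. y i t - y j t) \<longlongrightarrow> 0) at_top"
proof -
  let ?L = "cmat (laplacian m \<alpha>)"
  have L: "?L \<in> carrier_mat m m"
    by simp
  obtain P T R where P: "P \<in> carrier_mat m m" and T: "T \<in> carrier_mat m m"
    and R: "R \<in> carrier_mat m m" and PR: "P * R = 1\<^sub>m m" and RP: "R * P = 1\<^sub>m m"
    and LP: "?L * P = P * T" and RL: "R * ?L = T * R"
    and up: "upper_triangular T" and diag: "\<And>i. i < m \<Longrightarrow> T $$ (i, i) = lamL ! i"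
    by (rule complex_triangularization[OF L lamL[unfolded eigenvalues_def]]) blast
  define Y where "Y = (\<lambda>t. Matrix.vec m (\<lambda>i. y i t))"
  have Y: "Y t \<in> carrier_vec m" for t
    by (simp add: Y_def)
  define z where "z = (\<lambda>i t. \<Sum>j\<in>{0..<m}. R $$ (i, j) * y j t)"
  have z_eq: "(R *\<^sub>v Y t) = Matrix.vec m (\<lambda>i. z i t)" for t
    using R by (intro eq_vecI) (auto simp: z_def Y_def scalar_prod_def)
  \<comment> \<open>Coefficient matrix \<open>l * 1 - g * T\<close> of the system for
    \<open>z = R y\<close>.\<close>
  define c where "c = (\<lambda>i k. (if i = k then l else 0) - g * T $$ (i, k))"
  have z': "(z i has_vector_derivative (\<Sum>k\<in>{0..<m}. c i k * z k t)) (at t within {0..})"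
    if i: "i < m" and t: "t \<ge> 0" for i t
  proof -
    have y': "(y j has_vector_derivative l * y j t - g * (?L *\<^sub>v Y t) $ j) (at t within {0..})"
      if "j < m" for j
    proof -
      have "(?L *\<^sub>v Y t) $ j = (\<Sum>k\<in>{0..<m}. complex_of_real (\<alpha> j k) * (y j t - y k t))"
        unfolding laplacian_mult_vec_index[OF Y that] using that by (simp add: Y_def)
      also have "\<dots> = - (\<Sum>k\<in>{0..<m}. complex_of_real (\<alpha> j k) * (y k t - y j t))"
        by (simp add: sum_negf[symmetric] algebra_simps)
      finally show ?thesis
        using y[OF that t] by simp
    qed
    have "(z i has_vector_derivative
        (\<Sum>j\<in>{0..<m}. R $$ (i, j) * (l * y j t - g * (?L *\<^sub>v Y t) $ j))) (at t within {0..})"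
      unfolding z_def
      by (intro has_vector_derivative_sum has_vector_derivative_mult_right y') auto
    also have "(\<Sum>j\<in>{0..<m}. R $$ (i, j) * (l * y j t - g * (?L *\<^sub>v Y t) $ j))
        = l * z i t - g * (\<Sum>j\<in>{0..<m}. R $$ (i, j) * (?L *\<^sub>v Y t) $ j)"
      by (simp add: z_def sum_distrib_left sum_subtractf[symmetric] algebra_simps)
    also have "(\<Sum>j\<in>{0..<m}. R $$ (i, j) * (?L *\<^sub>v Y t) $ j) = (R *\<^sub>v (?L *\<^sub>v Y t)) $ i"
      using R i by (simp add: scalar_prod_def laplacian_def)
    \<comment> \<open>The intertwining relation \<open>R * L = T * R\<close> makes the coupling
      triangular.\<close>
    also have "R *\<^sub>v (?L *\<^sub>v Y t) = T *\<^sub>v (R *\<^sub>v Y t)"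
      using assoc_mult_mat_vec[OF R L Y] assoc_mult_mat_vec[OF T R Y] RL by simp
    also have "(T *\<^sub>v (R *\<^sub>v Y t)) $ i = (\<Sum>k\<in>{0..<m}. T $$ (i, k) * z k t)"
      unfolding z_eq using T i by (simp add: scalar_prod_def)
    also have "l * z i t - g * (\<Sum>k\<in>{0..<m}. T $$ (i, k) * z k t) = (\<Sum>k\<in>{0..<m}. c i k * z k t)"
    proof -
      have "l * z i t = (\<Sum>k\<in>{0..<m}. (if i = k then l else 0) * z k t)"
        using i by (simp add: if_distrib[of "\<lambda>x. x * _"] cong: if_cong)
      then show ?thesis
        by (simp add: c_def sum_distrib_left left_diff_distrib sum_subtractf mult.assoc)
    qed
    finally show ?thesis .
  qed
  have z_0: "(z k \<longlongrightarrow> 0) at_top" if "1 \<le> k" "k < m" for k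
  proof (rule upper_triangular_ode_tendsto_0[of m z c, OF z' _ _ that])
    show "c i j = 0" if "i < m" "j < i" for i j
      using upper_triangularD[OF up, of j i] that T by (simp add: c_def)
    show "Re (c i i) < 0" if "1 \<le> i" "i < m" for i
      using stable[OF that] that by (simp add: c_def diag)
  qed
  have y_eq: "y i t = (\<Sum>k\<in>{0..<m}. P $$ (i, k) * z k t)" if "i < m" for i t
  proof -
    have "Y t = P *\<^sub>v (R *\<^sub>v Y t)"
      using assoc_mult_mat_vec[OF P R Y] PR Y by simp
    then have "Y t $ i = (P *\<^sub>v (R *\<^sub>v Y t)) $ i"
      by simp
    then show ?thesis
      unfolding z_eq using P that by (simp add: Y_def scalar_prod_def)
  qed
  have "col T 0 = 0\<^sub>v m"
  proof (rule eq_vecI)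
    fix i assume "i < dim_vec (0\<^sub>v m :: complex Matrix.vec)"
    then show "col T 0 $ i = 0\<^sub>v m $ i"
      using upper_triangularD[OF up, of 0 i] diag[of 0] zero T m by (cases "i = 0") auto
  qed (use T in auto)
  moreover have "P *\<^sub>v 0\<^sub>v m = 0\<^sub>v m"
    by (rule eq_vecI) (use P in auto)
  ultimately have "?L *\<^sub>v col P 0 = 0\<^sub>v m"
    using col_mult2[OF L P, of 0] col_mult2[OF P T, of 0] LP m by simp
  moreover have "col P 0 \<in> carrier_vec m"
    using col_dim[of P 0] P by simp
  ultimately have "col P 0 $ i = col P 0 $ j"
    using laplacian_kernel_const[OF nonneg conn] ij by blast
  then have "P $$ (i, 0) = P $$ (j, 0)"
    using P ij m by simp
  \<comment> \<open>The coefficient of \<open>z 0\<close> is zero, and all other modes tend to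
    0.\<close>
  have "y i t - y j t = (\<Sum>k\<in>{0..<m}. (P $$ (i, k) - P $$ (j, k)) * z k t)" for t
    using ij by (simp add: y_eq sum_subtractf left_diff_distrib)
  moreover have "((\<lambda>t. \<Sum>k\<in>{0..<m}. (P $$ (i, k) - P $$ (j, k)) * z k t) \<longlongrightarrow> 0) at_top"
  proof (rule tendsto_null_sum)
    fix k assume k: "k \<in> {0..<m}"
    show "((\<lambda>t. (P $$ (i, k) - P $$ (j, k)) * z k t) \<longlongrightarrow> 0) at_top"
    proof (cases "k = 0")
      case True
      then show ?thesis
        using \<open>P $$ (i, 0) = P $$ (j, 0)\<close> by simp
    next
      case False
      then show ?thesis
        using z_0[of k] k by (intro tendsto_mult_right_zero) auto
    qed
  qed
  ultimately show ?thesis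
    by simp
qed

section \<open>Passage between the vector system and its coordinates\<close>

lemma multi_agent_rhs_index:
  fixes x :: "nat \<Rightarrow> complex Matrix.vec"
  assumes x: "\<And>j. j < m \<Longrightarrow> x j \<in> carrier_vec n" and i: "i < m" and k: "k < n"
  shows "(mat_diag n lamA *\<^sub>v x i + cmat (mat_diag n \<gamma>) *\<^sub>v finsum_vec TYPE(complex) n
      (\<lambda>j. complex_of_real (\<alpha> i j) \<cdot>\<^sub>v (x j - x i)) {0..<m}) $ k
    = lamA k * x i $ k + complex_of_real (\<gamma> k) *
      (\<Sum>j\<in>{0..<m}. complex_of_real (\<alpha> i j) * (x j $ k - x i $ k))"
proof -
  have diag: "(mat_diag n f *\<^sub>v v) $ k = f k * v $ k" if "v \<in> carrier_vec n" for f and v :: "complex Matrix.vec"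
    using that k by (simp add: mat_diag_def scalar_prod_def if_distrib[of "\<lambda>x. x * _"] cong: if_cong)
  have cdiag: "cmat (mat_diag n \<gamma>) = mat_diag n (\<lambda>k. complex_of_real (\<gamma> k))"
    by (intro eq_matI) (auto simp: mat_diag_def)
  let ?f = "\<lambda>j. complex_of_real (\<alpha> i j) \<cdot>\<^sub>v (x j - x i)"
  have f: "?f \<in> {0..<m} \<rightarrow> carrier_vec n"
    using x i by auto
  have "finsum_vec TYPE(complex) n ?f {0..<m} $ k
      = (\<Sum>j\<in>{0..<m}. complex_of_real (\<alpha> i j) * (x j $ k - x i $ k))"
    unfolding index_finsum_vec[OF finite_atLeastLessThan k f]
  proof (rule sum.cong)
    fix j assume "j \<in> {0..<m}"
    then have "dim_vec (x j) = n" "dim_vec (x i) = n"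
      using x i by (auto intro: carrier_vecD)
    then show "?f j $ k = complex_of_real (\<alpha> i j) * (x j $ k - x i $ k)"
      using k by simp
  qed simp
  then show ?thesis
    unfolding cdiag using x i k diag[of "x i"] diag[OF finsum_vec_closed[OF f]]
    by (simp add: mat_diag_def del: index_mult_mat_vec)
qed

lemma multi_agent_solution_coordinates:
  "multi_agent_solution n m (mat_diag n lamA) (cmat (mat_diag n \<gamma>)) \<alpha> x \<longleftrightarrow>
    (\<forall>i<m. \<forall>t\<ge>0. x i t \<in> carrier_vec n \<and>
      (\<forall>k<n. ((\<lambda>s. x i s $ k) has_vector_derivative
        lamA k * x i t $ k + complex_of_real (\<gamma> k) *
          (\<Sum>j\<in>{0..<m}. complex_of_real (\<alpha> i j) * (x j t $ k - x i t $ k))) (at t within {0..})))"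
\<comment> \<open>The coordinate formula presupposes that all states have dimension
  \<open>n\<close>; otherwise both sides are false.\<close>
proof (cases "\<forall>i<m. \<forall>t\<ge>0. x i t \<in> carrier_vec n")
  case True
  have "(mat_diag n lamA *\<^sub>v x i t + cmat (mat_diag n \<gamma>) *\<^sub>v finsum_vec TYPE(complex) n
        (\<lambda>j. complex_of_real (\<alpha> i j) \<cdot>\<^sub>v (x j t - x i t)) {0..<m}) $ k
      = lamA k * x i t $ k + complex_of_real (\<gamma> k) *
        (\<Sum>j\<in>{0..<m}. complex_of_real (\<alpha> i j) * (x j t $ k - x i t $ k))"
    if "i < m" "t \<ge> 0" "k < n" for i t k
    by (rule multi_agent_rhs_index) (use True that in auto)
  then show ?thesis
    unfolding multi_agent_solution_def has_vec_derivative_within_def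
    by (intro iff_allI imp_cong conj_cong refl) presburger
next
  case False
  then show ?thesis
    unfolding multi_agent_solution_def by blast
qed

text \<open>The eigenvector, placed in coordinate \<open>k\<close>, gives an explicit solution whose
  node differences cannot decay unless they vanish from the start.\<close>

lemma consensus_unstable_mode_const:
  assumes cons: "reaches_consensus n m (mat_diag n lamA) (cmat (mat_diag n \<gamma>)) \<alpha>"
    and k: "k < n" and ev: "eigenvector (cmat (laplacian m \<alpha>)) v l"
    and unstable: "Re (lamA k - complex_of_real (\<gamma> k) * l) \<ge> 0"
    and ij: "i < m" "j < m"
  shows "v $ i = v $ j"
proof -
  have v: "v \<in> carrier_vec m" "cmat (laplacian m \<alpha>) *\<^sub>v v = l \<cdot>\<^sub>v v"
    using ev by (auto simp: eigenvector_def laplacian_def)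
  define \<mu> where "\<mu> = lamA k - complex_of_real (\<gamma> k) * l"
  define x where "x = (\<lambda>i t. Matrix.vec n (\<lambda>q. if q = k then exp (of_real t * \<mu>) * v $ i else 0))"
  have x_carrier: "x i t \<in> carrier_vec n" for i t
    by (simp add: x_def)
  have "multi_agent_solution n m (mat_diag n lamA) (cmat (mat_diag n \<gamma>)) \<alpha> x"
    unfolding multi_agent_solution_coordinates
  proof (intro allI impI conjI x_carrier)
    fix i t q assume i: "i < m" and q: "q < n"
    let ?D = "lamA q * x i t $ q + complex_of_real (\<gamma> q) *
          (\<Sum>j\<in>{0..<m}. complex_of_real (\<alpha> i j) * (x j t $ q - x i t $ q))"
    show "((\<lambda>s. x i s $ q) has_vector_derivative ?D) (at t within {0..})"
    proof (cases "q = k")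
      case False
      then show ?thesis
        using q by (simp add: x_def)
    next
      case True
      let ?e = "exp (of_real t * \<mu>)"
      have "l * v $ i = (\<Sum>j\<in>{0..<m}. complex_of_real (\<alpha> i j) * (v $ i - v $ j))"
        using laplacian_mult_vec_index[OF v(1) i, of \<alpha>] v i by simp
      also have "\<dots> = - (\<Sum>j\<in>{0..<m}. complex_of_real (\<alpha> i j) * (v $ j - v $ i))"
        by (simp add: sum_negf[symmetric] algebra_simps)
      finally have sum_v: "(\<Sum>j\<in>{0..<m}. complex_of_real (\<alpha> i j) * (v $ j - v $ i)) = - (l * v $ i)"
        by simp
      have "(\<Sum>j\<in>{0..<m}. complex_of_real (\<alpha> i j) * (x j t $ q - x i t $ q))
          = ?e * (\<Sum>j\<in>{0..<m}. complex_of_real (\<alpha> i j) * (v $ j - v $ i))"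
        using True k by (simp add: x_def sum_distrib_left algebra_simps)
      then have "?D = ?e * \<mu> * v $ i"
        unfolding sum_v using True k by (simp add: x_def \<mu>_def algebra_simps)
      moreover have "((\<lambda>s. exp (of_real s * \<mu>) * v $ i) has_vector_derivative ?e * \<mu> * v $ i)
          (at t within {0..})"
        using has_vector_derivative_mult_left[OF
            exp_scaleR_has_vector_derivative_right[of \<mu> t "{0..}"], of "v $ i"]
        by (simp add: scaleR_conv_of_real)
      ultimately show ?thesis
        using True k by (simp add: x_def)
    qed
  qed
  then have lim: "((\<lambda>t. euclidean_norm (x i t - x j t)) \<longlongrightarrow> 0) at_top"
    using cons ij x_carrier unfolding reaches_consensus_def
    by (elim allE[of _ "\<lambda>i. x i 0"]) auto
  have norm_ge: "cmod (v $ i - v $ j) \<le> euclidean_norm (x i t - x j t)" if "t \<ge> 0" for t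
  proof -
    \<comment> \<open>The exponential has modulus at least 1 because \<open>Re \<mu> \<ge> 0\<close>
      and \<open>t \<ge> 0\<close>.\<close>
    have "1 * cmod (v $ i - v $ j) \<le> cmod (exp (of_real t * \<mu>)) * cmod (v $ i - v $ j)"
      using unstable that by (intro mult_right_mono) (simp_all flip: \<mu>_def)
    also have "\<dots> = cmod ((x i t - x j t) $ k)"
    proof -
      have "(x i t - x j t) $ k = exp (of_real t * \<mu>) * (v $ i - v $ j)"
        using k by (simp add: x_def right_diff_distrib)
      then show ?thesis
        by (simp only: norm_mult)
    qed
    also have "\<dots> \<le> euclidean_norm (x i t - x j t)"
      unfolding euclidean_norm_def using k
      by (intro member_le_L2_set[of _ k "\<lambda>k. cmod ((x i t - x j t) $ k)"]) (auto simp: x_def)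
    finally show ?thesis
      by simp
  qed
  have "cmod (v $ i - v $ j) \<le> 0"
    by (intro tendsto_lowerbound[OF lim] eventually_mono[OF eventually_ge_at_top[of 0]] norm_ge) auto
  then show ?thesis
    by simp
qed

lemma reaches_consensus_if_coordinates:
  assumes "\<And>x i j k. multi_agent_solution n m S \<Gamma> \<alpha> x \<Longrightarrow> i < m \<Longrightarrow> j < m \<Longrightarrow> k < n \<Longrightarrow>
      ((\<lambda>t. x i t $ k - x j t $ k) \<longlongrightarrow> 0) at_top"
  shows "reaches_consensus n m S \<Gamma> \<alpha>"
  unfolding reaches_consensus_def
proof (intro allI impI; elim conjE)
  fix x i j
  assume sol: "multi_agent_solution n m S \<Gamma> \<alpha> x" and ij: "i < m" "j < m"
  have "((\<lambda>t. L2_set (\<lambda>k. cmod (x i t $ k - x j t $ k)) {0..<n}) \<longlongrightarrow> sqrt (\<Sum>k\<in>{0..<n}. (cmod 0)\<^sup>2)) at_top"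
    unfolding L2_set_def using assms[OF sol ij]
    by (intro tendsto_real_sqrt tendsto_sum tendsto_power tendsto_norm) auto
  then have lim: "((\<lambda>t. L2_set (\<lambda>k. cmod (x i t $ k - x j t $ k)) {0..<n}) \<longlongrightarrow> 0) at_top"
    by simp
  \<comment> \<open>The norm sums up to the dimension of its argument, which is known to be
    \<open>n\<close> only for \<open>t \<ge> 0\<close>.\<close>
  have "\<forall>\<^sub>F t in at_top. euclidean_norm (x i t - x j t) = L2_set (\<lambda>k. cmod (x i t $ k - x j t $ k)) {0..<n}"
    using eventually_ge_at_top[of 0]
  proof eventually_elim
    case (elim t)
    then have "x i t \<in> carrier_vec n" "x j t \<in> carrier_vec n"
      using sol ij by (auto simp: multi_agent_solution_def)
    then show ?case
      unfolding euclidean_norm_def by (intro L2_set_cong) auto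
  qed
  then show "((\<lambda>t. euclidean_norm (x i t - x j t)) \<longlongrightarrow> 0) at_top"
    using lim by (rule tendsto_cong[THEN iffD2])
qed

section \<open>The consensus criterion\<close>

theorem theorem1:
  fixes m n r :: nat
    and A :: "real mat" and Q Qinv S :: "complex mat"
    and lamA :: "nat \<Rightarrow> complex" and lamL :: "complex list"
    and \<alpha> :: "nat \<Rightarrow> nat \<Rightarrow> real" and \<gamma> :: "nat \<Rightarrow> real"
  assumes "m \<ge> 2" and "n \<ge> 1" and "r \<ge> 1"
    and "A \<in> carrier_mat n n"
    and "diagonalizable (cmat A)"
    and "size (filter_mset (\<lambda>z. Re z > 0) (eigenvalues (cmat A))) = r"
    and "Q \<in> carrier_mat n n" and "Qinv \<in> carrier_mat n n"
    and "inverts_mat Q Qinv" and "inverts_mat Qinv Q"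
    and "\<forall>k<n. eigenvector (cmat A) (col Q k) (lamA k)"
    and "S = Qinv * cmat A * Q"
    and "S = mat_diag n lamA"
    and "\<forall>i j. i \<le> j \<and> j < n \<longrightarrow> Re (lamA i) \<ge> Re (lamA j)"
    and "\<forall>i<r. Re (lamA i) > 0"
    and "\<forall>i. r \<le> i \<and> i < n \<longrightarrow> Re (lamA i) \<le> 0"
    and "\<forall>i<m. \<forall>j<m. i \<noteq> j \<longrightarrow> \<alpha> i j \<ge> 0"
    and "connected_graph m \<alpha>"
    and "mset lamL = eigenvalues (cmat (laplacian m \<alpha>))"
    and "sorted (map Re lamL)"
    and "\<forall>i. r \<le> i \<and> i < n \<longrightarrow> \<gamma> i = 1"
  shows "reaches_consensus n m S (cmat (mat_diag n \<gamma>)) \<alpha> \<longleftrightarrow>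
    (\<forall>i<r. \<gamma> i > Re (lamA i) / Re (lamL ! 1))"
proof -
  note m = assms(1) and nonneg = assms(17) and conn = assms(18) and lamL = assms(19)
    and sorted = assms(20) and S = assms(13)
  note spectrum = laplacian_spectrum[OF m nonneg conn lamL sorted]
  let ?L = "cmat (laplacian m \<alpha>)" and ?l2 = "Re (lamL ! 1)"
  \<comment> \<open>Ensures that every index below \<open>r\<close> is an actual coordinate.\<close>
  have "r \<le> size (eigenvalues (cmat A))"
    unfolding assms(6)[symmetric] by (rule size_filter_mset_lesseq)
  also have "\<dots> = n"
    using degree_monic_char_poly[of "cmat A" n] assms(4) by (simp add: eigenvalues_def size_proots_complex)
  finally have "r \<le> n" .
  show ?thesis
  proof
    assume cons: "reaches_consensus n m S (cmat (mat_diag n \<gamma>)) \<alpha>"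
    show "\<forall>i<r. \<gamma> i > Re (lamA i) / ?l2"
    proof (intro allI impI, rule ccontr)
      fix k assume k: "k < r" and "\<not> \<gamma> k > Re (lamA k) / ?l2"
      then have unstable: "Re (lamA k - complex_of_real (\<gamma> k) * lamL ! 1) \<ge> 0"
        using spectrum(3) by (simp add: not_less pos_le_divide_eq)
      have "lamL ! 1 \<in># mset lamL"
        using spectrum(1) m by simp
      then have "eigenvalue ?L (lamL ! 1)"
        unfolding lamL using m by (simp add: mem_eigenvalues_laplacian_iff)
      then obtain v where v: "eigenvector ?L v (lamL ! 1)"
        by (auto simp: eigenvalue_def)
      then have v_carrier: "v \<in> carrier_vec m" "v \<noteq> 0\<^sub>v m" "?L *\<^sub>v v = lamL ! 1 \<cdot>\<^sub>v v"
        by (auto simp: eigenvector_def laplacian_def)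
      have const: "v $ i = v $ 0" if "i < m" for i
        using consensus_unstable_mode_const[OF cons[unfolded S] _ v unstable that] k \<open>r \<le> n\<close> m by simp
      have v_const: "v = Matrix.vec m (\<lambda>_. v $ 0)"
      proof (rule eq_vecI)
        fix i assume "i < dim_vec (Matrix.vec m (\<lambda>_. v $ 0))"
        then show "v $ i = Matrix.vec m (\<lambda>_. v $ 0) $ i"
          using const[of i] by simp
      qed (use v_carrier(1) in auto)
      \<comment> \<open>A constant vector lies in the kernel, whereas its eigenvalue
        \<open>lamL ! 1\<close> is nonzero.\<close>
      have "lamL ! 1 \<cdot>\<^sub>v v = 0\<^sub>v m"
        unfolding v_carrier(3)[symmetric] by (subst v_const) (rule laplacian_mult_const_vec)
      then have "(lamL ! 1 \<cdot>\<^sub>v v) $ i = 0" if "i < m" for i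
        using that by simp
      moreover have "lamL ! 1 \<noteq> 0"
        using spectrum(3) by auto
      ultimately have "v $ i = 0" if "i < m" for i
        using that v_carrier(1) by simp
      then have "v = 0\<^sub>v m"
        using v_carrier(1) by (intro eq_vecI) auto
      with v_carrier(2) show False ..
    qed
  next
    assume gain: "\<forall>i<r. \<gamma> i > Re (lamA i) / ?l2"
    \<comment> \<open>The sign of \<open>\<gamma> k\<close> is recorded because it later multiplies
      the inequality between eigenvalues.\<close>
    have pos: "\<gamma> k \<ge> 0 \<and> Re (lamA k) < \<gamma> k * ?l2" if "k < n" for k
    proof (cases "k < r")
      case True
      then have "Re (lamA k) / ?l2 < \<gamma> k" and Re_pos: "Re (lamA k) > 0"
        using gain assms(15) by blast+
      from this(1) have less: "Re (lamA k) < \<gamma> k * ?l2"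
        using spectrum(3) by (simp add: pos_divide_less_eq)
      then have "\<gamma> k > 0"
        using Re_pos spectrum(3) zero_less_mult_pos2[of "\<gamma> k" ?l2] by linarith
      with less show ?thesis
        by simp
    next
      case False
      then have "\<gamma> k = 1" "Re (lamA k) \<le> 0"
        using assms(16,21) that not_less by blast+
      then show ?thesis
        using spectrum(3) by simp
    qed
    show "reaches_consensus n m S (cmat (mat_diag n \<gamma>)) \<alpha>"
    proof (rule reaches_consensus_if_coordinates)
      fix x i j k
      assume "multi_agent_solution n m S (cmat (mat_diag n \<gamma>)) \<alpha> x"
        and ij: "i < m" "j < m" and k: "k < n"
      then have sol: "((\<lambda>s. x i s $ k) has_vector_derivative
          lamA k * x i t $ k + complex_of_real (\<gamma> k) *
            (\<Sum>j\<in>{0..<m}. complex_of_real (\<alpha> i j) * (x j t $ k - x i t $ k))) (at t within {0..})"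
        if "i < m" "t \<ge> 0" for i t
        using that unfolding S multi_agent_solution_coordinates by blast
      show "((\<lambda>t. x i t $ k - x j t $ k) \<longlongrightarrow> 0) at_top"
      proof (rule scalar_consensus[of m \<alpha> lamL "\<lambda>i t. x i t $ k" "lamA k" "complex_of_real (\<gamma> k)",
            OF m nonneg conn lamL spectrum(2) sol _ ij])
        fix q assume q: "1 \<le> q" "q < m"
        \<comment> \<open>With a nonnegative gain, the second eigenvalue is the worst case among all
          \<open>q \<ge> 1\<close>.\<close>
        then have "?l2 \<le> Re (lamL ! q)"
          using sorted_nth_mono[OF sorted, of 1 q] spectrum(1) by simp
        then have "\<gamma> k * ?l2 \<le> \<gamma> k * Re (lamL ! q)"
          using pos[OF k] by (intro mult_left_mono) auto
        then show "Re (lamA k - complex_of_real (\<gamma> k) * lamL ! q) < 0"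
          using pos[OF k] by simp
      qed
    qed
  qed
qed

end
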